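(* Let $M=\begin{pmatrix} a & b\\ d & \theta\end{pmatrix}$ and $M_k=\begin{pmatrix} a_k & b_k\\ d_k & \theta_k\end{pmatrix}$, $k\ge1$, be real $2\times 2$ matrices with nonnegative entries such that $\lim_{k\to\infty}M_k=M$, $a+\theta\neq0$, $b\neq0$ and $bd\neq a\theta$. Let $\varrho=\frac{a+\theta+\sqrt{(a+\theta)^2+4(bd-a\theta)}}{2}$ and $\varrho_1=\frac{a+\theta-\sqrt{(a+\theta)^2+4(bd-a\theta)}}{2}$, and let $A_k$ and $\xi_n$ be as defined in the context. Then there exists $k_0>0$ such that for all $k\ge k_0$ and all $i,j\in\{1,2\}$, $$\frac{\mathbf e_iA_{k+1}\cdots A_{k+n}\mathbf e_j^t}{\xi_{k+1}^{-1}\cdots\xi_{k+n}^{-1}}\longrightarrow\phi(i,j,k)\quad\text{as }n\to\infty,$$ uniformly in $k\ge k_0$, where $\phi(1,1,k)=\frac{\varrho}{\varrho-\varrho_1}$, $\phi(1,2,k)=\frac{b}{\varrho-\varrho_1}$, $\phi(2,1,k)=\frac{\tilde d_{k+1}}{\xi_{k+1}^{-1}}\frac{\varrho}{\varrho-\varrho_1}$ and $\phi(2,2,k)=\frac{\tilde d_{k+1}}{\xi_{k+1}^{-1}}\frac{b}{\varrho-\varrho_1}$.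
   Context: $\mathbf e_1=(1,0)$, $\mathbf e_2=(0,1)$ are row vectors and $\mathbf v^t$ is the transpose. For $k\ge1$ (whenever defined, which holds for all large $k$) let $$A_k=\begin{pmatrix}\tilde a_k & \tilde b_k\\ \tilde d_k & 0\end{pmatrix},\quad \tilde a_k=a_k+\frac{b_k\theta_{k+1}}{b_{k+1}},\ \tilde b_k=b_k,\ \tilde d_k=d_k-\frac{a_k\theta_k}{b_k}.$$ Set $\beta_n=\tilde b_n^{-1}\tilde d_{n+1}^{-1}$ and $\alpha_n=\tilde a_n\tilde b_n^{-1}\tilde d_{n+1}^{-1}$, and let $\xi_n$ be the value (limit of the approximants) of the continued fraction $$\xi_n=\cfrac{\beta_n}{\alpha_n+\cfrac{\beta_{n+1}}{\alpha_{n+1}+\cfrac{\beta_{n+2}}{\alpha_{n+2}+\cdots}}}.$$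
   Formalization: The formal theorem additionally assumes ϱ ≠ ϱ₁, which fails only when a = θ > 0 and d = 0; there φ divides by zero, and for M_k = M the (1,1) quotient equals n+1 and diverges. *)

theory Defs
  imports "HOL-Analysis.Analysis"
begin

definition mat22 :: "real \<Rightarrow> real \<Rightarrow> real \<Rightarrow> real \<Rightarrow> real^2^2" where
  "mat22 p q r s = vector [vector [p, q], vector [r, s]]"

definition rho :: "real \<Rightarrow> real \<Rightarrow> real \<Rightarrow> real \<Rightarrow> real" where
  "rho a b d \<theta> = (a + \<theta> + sqrt ((a + \<theta>)\<^sup>2 + 4 * (b * d - a * \<theta>))) / 2"

definition rho1 :: "real \<Rightarrow> real \<Rightarrow> real \<Rightarrow> real \<Rightarrow> real" where
  "rho1 a b d \<theta> = (a + \<theta> - sqrt ((a + \<theta>)\<^sup>2 + 4 * (b * d - a * \<theta>))) / 2"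

definition a_til :: "(nat \<Rightarrow> real) \<Rightarrow> (nat \<Rightarrow> real) \<Rightarrow> (nat \<Rightarrow> real) \<Rightarrow> nat \<Rightarrow> real" where
  "a_til as bs \<theta>s k = as k + bs k * \<theta>s (k + 1) / bs (k + 1)"

definition d_til ::
  "(nat \<Rightarrow> real) \<Rightarrow> (nat \<Rightarrow> real) \<Rightarrow> (nat \<Rightarrow> real) \<Rightarrow> (nat \<Rightarrow> real) \<Rightarrow> nat \<Rightarrow> real" where
  "d_til as bs ds \<theta>s k = ds k - as k * \<theta>s k / bs k"

definition A_mat ::
  "(nat \<Rightarrow> real) \<Rightarrow> (nat \<Rightarrow> real) \<Rightarrow> (nat \<Rightarrow> real) \<Rightarrow> (nat \<Rightarrow> real) \<Rightarrow> nat \<Rightarrow> real^2^2" where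
  "A_mat as bs ds \<theta>s k = mat22 (a_til as bs \<theta>s k) (bs k) (d_til as bs ds \<theta>s k) 0"

definition cf_beta ::
  "(nat \<Rightarrow> real) \<Rightarrow> (nat \<Rightarrow> real) \<Rightarrow> (nat \<Rightarrow> real) \<Rightarrow> (nat \<Rightarrow> real) \<Rightarrow> nat \<Rightarrow> real" where
  "cf_beta as bs ds \<theta>s n = inverse (bs n) * inverse (d_til as bs ds \<theta>s (n + 1))"

definition cf_alpha ::
  "(nat \<Rightarrow> real) \<Rightarrow> (nat \<Rightarrow> real) \<Rightarrow> (nat \<Rightarrow> real) \<Rightarrow> (nat \<Rightarrow> real) \<Rightarrow> nat \<Rightarrow> real" where
  "cf_alpha as bs ds \<theta>s n =
     a_til as bs \<theta>s n * inverse (bs n) * inverse (d_til as bs ds \<theta>s (n + 1))"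

text \<open>
  \<open>cf_approx \<alpha> \<beta> m n\<close> is the approximant with \<open>m\<close> partial quotients, starting at index \<open>n\<close>:
  \<open>\<beta> n / (\<alpha> n + \<beta> (n+1) / (\<alpha> (n+1) + \<dots> + \<beta> (n+m-1) / \<alpha> (n+m-1)))\<close>.
  It has this meaning only as long as no denominator vanishes.
\<close>

primrec cf_approx :: "(nat \<Rightarrow> real) \<Rightarrow> (nat \<Rightarrow> real) \<Rightarrow> nat \<Rightarrow> nat \<Rightarrow> real" where
  "cf_approx \<alpha> \<beta> 0 n = 0"
| "cf_approx \<alpha> \<beta> (Suc m) n = \<beta> n / (\<alpha> n + cf_approx \<alpha> \<beta> m (n + 1))"

definition xi ::
  "(nat \<Rightarrow> real) \<Rightarrow> (nat \<Rightarrow> real) \<Rightarrow> (nat \<Rightarrow> real) \<Rightarrow> (nat \<Rightarrow> real) \<Rightarrow> nat \<Rightarrow> real" where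
  "xi as bs ds \<theta>s n =
     lim (\<lambda>m. cf_approx (cf_alpha as bs ds \<theta>s) (cf_beta as bs ds \<theta>s) m n)"

text \<open>All quantities entering the definition of \<open>xi as bs ds \<theta>s n\<close> and of its
  reciprocal at index \<open>n\<close> are meaningful: no division by zero, and the approximants converge.\<close>

definition xi_defined ::
  "(nat \<Rightarrow> real) \<Rightarrow> (nat \<Rightarrow> real) \<Rightarrow> (nat \<Rightarrow> real) \<Rightarrow> (nat \<Rightarrow> real) \<Rightarrow> nat \<Rightarrow> bool" where
  "xi_defined as bs ds \<theta>s n \<longleftrightarrow>
     bs n \<noteq> 0 \<and> d_til as bs ds \<theta>s n \<noteq> 0 \<and>
     (\<forall>m. cf_alpha as bs ds \<theta>s n
            + cf_approx (cf_alpha as bs ds \<theta>s) (cf_beta as bs ds \<theta>s) m (n + 1) \<noteq> 0) \<and>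
     convergent (\<lambda>m. cf_approx (cf_alpha as bs ds \<theta>s) (cf_beta as bs ds \<theta>s) m n) \<and>
     xi as bs ds \<theta>s n \<noteq> 0"

text \<open>\<open>mat_prod A k n = A (k+1) ** \<dots> ** A (k+n)\<close>\<close>

primrec mat_prod :: "(nat \<Rightarrow> real^2^2) \<Rightarrow> nat \<Rightarrow> nat \<Rightarrow> real^2^2" where
  "mat_prod A k 0 = mat 1"
| "mat_prod A k (Suc n) = mat_prod A k n ** A (k + Suc n)"

end

theory Submission
  imports Defs
begin

text \<open>The tails \<open>\<xi>\<^sub>n\<close> are values of a limit periodic continued fraction whose limiting Moebius map has
  the fixed points \<open>1 / \<rho>\<close> and \<open>1 / \<rho>\<^sub>1\<close>, of different modulus. For a fixed number of partial quotients
  the approximants tend, as the starting index grows, to those of the periodic fraction, which are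
  explicit and tend to \<open>1 / \<rho>\<close>; near \<open>1 / \<rho>\<close> all maps contract, so \<open>\<xi>\<^sub>n\<close> exists for large \<open>n\<close> and
  tends to \<open>1 / \<rho>\<close>. The vectors \<open>(1, d\<^sub>n \<xi>\<^sub>n)\<close> are carried into each other by the \<open>A\<^sub>n\<close> up to the factors
  \<open>\<xi>\<^sub>n\<^sup>-\<^sup>1\<close>. Hence every row of the normalised product satisfies one linear relation, and its second entry
  obeys an affine recursion whose linear coefficient tends to \<open>\<rho>\<^sub>1 / \<rho>\<close>; such a recursion converges
  uniformly in its starting index.\<close>

section \<open>Limit periodic continued fractions\<close>

text \<open>The coefficients are parametrised by the fixed points of the limiting map:
  \<open>x = \<beta> / (\<alpha> + x)\<close> means
  \<open>x\<^sup>2 + \<alpha> * x - \<beta> = 0\<close>, whose roots have sum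
  \<open>- \<alpha>\<close> and product \<open>- \<beta>\<close>. The derivative of that map at
  \<open>z1\<close> is \<open>z1 / z2\<close>, so \<open>abs_less\<close> makes \<open>z1\<close>
  the attracting one.\<close>

locale limit_periodic_cf =
  fixes \<alpha> \<beta> :: "nat \<Rightarrow> real" and z1 z2 :: real
  assumes alpha_lim: "\<alpha> \<longlonglongrightarrow> - (z1 + z2)"
    and beta_lim: "\<beta> \<longlonglongrightarrow> - (z1 * z2)"
    and abs_less: "\<bar>z1\<bar> < \<bar>z2\<bar>"
begin

abbreviation approx :: "nat \<Rightarrow> nat \<Rightarrow> real" where
  "approx \<equiv> cf_approx \<alpha> \<beta>"

definition cf_value :: "nat \<Rightarrow> real" where
  "cf_value n = lim (\<lambda>m. approx m n)"

lemma z2_nonzero: "z2 \<noteq> 0"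
  using abs_less by auto

lemma power_diff_nonzero: "z2 ^ Suc m - z1 ^ Suc m \<noteq> 0"
proof -
  have "\<bar>z1\<bar> ^ Suc m < \<bar>z2\<bar> ^ Suc m"
    using abs_less by (intro power_strict_mono) auto
  then show ?thesis
    by (metis eq_iff_diff_eq_0 less_irrefl power_abs)
qed

text \<open>Writes the limit of the denominators as a quotient of two terms covered by
  \<open>power_diff_nonzero\<close>, so that it is visibly nonzero.\<close>

lemma denominator_limit_eq:
  "- (z1 + z2) + z1 * z2 * (z2 ^ m - z1 ^ m) / (z2 ^ Suc m - z1 ^ Suc m)
   = - ((z2 ^ Suc (Suc m) - z1 ^ Suc (Suc m)) / (z2 ^ Suc m - z1 ^ Suc m))"
  using power_diff_nonzero[of m] by (simp add: divide_simps) (simp add: algebra_simps)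

text \<open>The limit is the \<open>m\<close>-th approximant of the periodic fraction with the
  limiting coefficients, solved in closed form by powers of the fixed points. Here \<open>m\<close>
  stays fixed while the starting index grows.\<close>

lemma approx_tendsto:
  "(\<lambda>n. approx m n) \<longlonglongrightarrow> z1 * z2 * (z2 ^ m - z1 ^ m) / (z2 ^ Suc m - z1 ^ Suc m)"
proof (induction m)
  case 0
  then show ?case by simp
next
  case (Suc m)
  have "(\<lambda>n. \<alpha> n + approx m (n + 1)) \<longlonglongrightarrow>
      - ((z2 ^ Suc (Suc m) - z1 ^ Suc (Suc m)) / (z2 ^ Suc m - z1 ^ Suc m))"
    unfolding denominator_limit_eq[symmetric]
    by (intro tendsto_add alpha_lim LIMSEQ_ignore_initial_segment Suc)
  then have "(\<lambda>n. \<beta> n / (\<alpha> n + approx m (n + 1))) \<longlonglongrightarrow>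
      - (z1 * z2) / - ((z2 ^ Suc (Suc m) - z1 ^ Suc (Suc m)) / (z2 ^ Suc m - z1 ^ Suc m))"
    using power_diff_nonzero[of m] power_diff_nonzero[of "Suc m"]
    by (intro tendsto_divide beta_lim) auto
  then show ?case
    by (simp del: power_Suc)
qed

lemma eventually_denominator_nonzero:
  "eventually (\<lambda>n. \<alpha> n + approx m (n + 1) \<noteq> 0) sequentially"
proof -
  have "(\<lambda>n. \<alpha> n + approx m (n + 1)) \<longlonglongrightarrow>
      - ((z2 ^ Suc (Suc m) - z1 ^ Suc (Suc m)) / (z2 ^ Suc m - z1 ^ Suc m))"
    unfolding denominator_limit_eq[symmetric]
    by (intro tendsto_add alpha_lim LIMSEQ_ignore_initial_segment approx_tendsto)
  then show ?thesis
    using power_diff_nonzero[of m] power_diff_nonzero[of "Suc m"]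
    by (intro tendsto_imp_eventually_ne) auto
qed

text \<open>Dividing by powers of \<open>z2\<close> leaves a geometric sequence of ratio
  \<open>z1 / z2\<close>.\<close>

lemma periodic_approx_tendsto:
  "(\<lambda>m. z1 * z2 * (z2 ^ m - z1 ^ m) / (z2 ^ Suc m - z1 ^ Suc m)) \<longlonglongrightarrow> z1"
proof -
  let ?q = "z1 / z2"
  have "\<bar>?q\<bar> < 1" using abs_less by (simp add: z2_nonzero)
  then have q: "(\<lambda>m. ?q ^ m) \<longlonglongrightarrow> 0" by (intro LIMSEQ_power_zero) simp
  have "(\<lambda>m. z1 * (1 - ?q ^ m) / (1 - ?q * ?q ^ m)) \<longlonglongrightarrow> z1 * (1 - 0) / (1 - ?q * 0)"
    by (intro tendsto_intros q) auto
  moreover have "z1 * (1 - ?q ^ m) / (1 - ?q * ?q ^ m)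
      = z1 * z2 * (z2 ^ m - z1 ^ m) / (z2 ^ Suc m - z1 ^ Suc m)" for m
  proof -
    have "1 - ?q ^ m = (z2 ^ m - z1 ^ m) / z2 ^ m"
      using z2_nonzero by (simp add: power_divide diff_divide_distrib)
    moreover have "1 - ?q * ?q ^ m = (z2 ^ Suc m - z1 ^ Suc m) / (z2 * z2 ^ m)"
      using z2_nonzero by (simp add: power_divide diff_divide_distrib)
    ultimately show ?thesis using z2_nonzero by simp
  qed
  ultimately show ?thesis by simp
qed

text \<open>The limiting map has a derivative of modulus less than 1 at \<open>z1\<close>; a small
  margin \<open>\<delta>\<close> in the coefficients and in the argument preserves this, with one
  constant for all late indices.\<close>

lemma contraction_near_z1:
  obtains \<eta> \<delta> N where "0 \<le> \<eta>" "\<eta> < 1" "0 < \<delta>"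
    "\<And>n x. n \<ge> N \<Longrightarrow> \<bar>x - z1\<bar> \<le> \<delta> \<Longrightarrow> \<alpha> n + x \<noteq> 0"
    "\<And>n x y. n \<ge> N \<Longrightarrow> \<bar>x - z1\<bar> \<le> \<delta> \<Longrightarrow> \<bar>y - z1\<bar> \<le> \<delta> \<Longrightarrow>
       \<bar>\<beta> n / (\<alpha> n + x) - \<beta> n / (\<alpha> n + y)\<bar> \<le> \<eta> * \<bar>x - y\<bar>"
proof -
  \<comment> \<open>With margin \<open>t\<close>, the numerator \<open>\<beta> n\<close> is at most
    \<open>\<bar>z1\<bar> * \<bar>z2\<bar> + t\<close> in modulus, and \<open>\<alpha> n + x\<close>
    is within \<open>2 * t\<close> of \<open>- z2\<close>. The quotient is thus a Lipschitz
    constant; at \<open>t = 0\<close> it is \<open>\<bar>z1\<bar> / \<bar>z2\<bar>\<close>.\<close>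
  have "((\<lambda>t. (\<bar>z1\<bar> * \<bar>z2\<bar> + t) / (\<bar>z2\<bar> - 2 * t)\<^sup>2) \<longlongrightarrow>
      (\<bar>z1\<bar> * \<bar>z2\<bar> + 0) / (\<bar>z2\<bar> - 2 * 0)\<^sup>2) (at_right 0)"
    using z2_nonzero by (intro tendsto_intros) auto
  moreover have "(\<bar>z1\<bar> * \<bar>z2\<bar> + 0) / (\<bar>z2\<bar> - 2 * 0)\<^sup>2 < 1"
  proof -
    have "\<bar>z1\<bar> * \<bar>z2\<bar> < \<bar>z2\<bar> * \<bar>z2\<bar>"
      using z2_nonzero abs_less by (intro mult_strict_right_mono) auto
    moreover have "0 < z2 * z2" using z2_nonzero by (auto simp: zero_less_mult_iff)
    ultimately show ?thesis by (simp add: power2_eq_square divide_less_eq)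
  qed
  ultimately have "eventually (\<lambda>t. (\<bar>z1\<bar> * \<bar>z2\<bar> + t) / (\<bar>z2\<bar> - 2 * t)\<^sup>2 < 1) (at_right 0)"
    by (rule order_tendstoD)
  moreover have "eventually (\<lambda>t. t \<in> {0<..<\<bar>z2\<bar> / 2}) (at_right 0)"
    using z2_nonzero by (intro eventually_at_right_real) auto
  ultimately have "eventually (\<lambda>t. (\<bar>z1\<bar> * \<bar>z2\<bar> + t) / (\<bar>z2\<bar> - 2 * t)\<^sup>2 < 1
      \<and> t \<in> {0<..<\<bar>z2\<bar> / 2}) (at_right 0)"
    by (rule eventually_conj)
  then obtain \<delta> where \<delta>: "(\<bar>z1\<bar> * \<bar>z2\<bar> + \<delta>) / (\<bar>z2\<bar> - 2 * \<delta>)\<^sup>2 < 1" "0 < \<delta>" "2 * \<delta> < \<bar>z2\<bar>"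
    using eventually_happens'[OF trivial_limit_at_right_real] by force
  define \<eta> where "\<eta> = (\<bar>z1\<bar> * \<bar>z2\<bar> + \<delta>) / (\<bar>z2\<bar> - 2 * \<delta>)\<^sup>2"
  have "eventually (\<lambda>n. dist (\<alpha> n) (- (z1 + z2)) < \<delta> \<and> dist (\<beta> n) (- (z1 * z2)) < \<delta>) sequentially"
    using tendstoD[OF alpha_lim \<delta>(2)] tendstoD[OF beta_lim \<delta>(2)] by eventually_elim auto
  then obtain N where N: "\<And>n. n \<ge> N \<Longrightarrow> \<bar>\<alpha> n - - (z1 + z2)\<bar> < \<delta> \<and> \<bar>\<beta> n - - (z1 * z2)\<bar> < \<delta>"
    unfolding eventually_sequentially dist_real_def by blast
  have low: "\<bar>z2\<bar> - 2 * \<delta> \<le> \<bar>\<alpha> n + x\<bar>" if "n \<ge> N" "\<bar>x - z1\<bar> \<le> \<delta>" for n x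
    using N[OF that(1)] that(2) by linarith
  have pos: "\<bar>\<alpha> n + x\<bar> > 0" if "n \<ge> N" "\<bar>x - z1\<bar> \<le> \<delta>" for n x
    using low[OF that] \<delta>(3) by linarith
  show ?thesis
  proof (rule that[of \<eta> \<delta> N])
    show "0 \<le> \<eta>" using \<delta> by (simp add: \<eta>_def)
    show "\<eta> < 1" using \<delta> by (simp add: \<eta>_def)
    show "0 < \<delta>" by fact
    show "\<alpha> n + x \<noteq> 0" if "n \<ge> N" "\<bar>x - z1\<bar> \<le> \<delta>" for n x
      using pos[OF that] by auto
    show "\<bar>\<beta> n / (\<alpha> n + x) - \<beta> n / (\<alpha> n + y)\<bar> \<le> \<eta> * \<bar>x - y\<bar>"
      if n: "n \<ge> N" and x: "\<bar>x - z1\<bar> \<le> \<delta>" and y: "\<bar>y - z1\<bar> \<le> \<delta>" for n x y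
    proof -
      have "\<bar>\<beta> n\<bar> \<le> \<bar>z1\<bar> * \<bar>z2\<bar> + \<delta>"
        using N[OF n] abs_mult[of z1 z2] by linarith
      moreover have "(\<bar>z2\<bar> - 2 * \<delta>)\<^sup>2 \<le> \<bar>\<alpha> n + x\<bar> * \<bar>\<alpha> n + y\<bar>"
        unfolding power2_eq_square using low[OF n x] low[OF n y] \<delta> by (intro mult_mono) auto
      ultimately have le: "\<bar>\<beta> n\<bar> / (\<bar>\<alpha> n + x\<bar> * \<bar>\<alpha> n + y\<bar>) \<le> \<eta>"
        unfolding \<eta>_def using \<delta> by (intro frac_le) auto
      have "\<beta> n / (\<alpha> n + x) - \<beta> n / (\<alpha> n + y) = \<beta> n / ((\<alpha> n + x) * (\<alpha> n + y)) * (y - x)"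
        using pos[OF n x] pos[OF n y] by (simp add: divide_simps) (simp add: algebra_simps)
      then have "\<bar>\<beta> n / (\<alpha> n + x) - \<beta> n / (\<alpha> n + y)\<bar>
          = \<bar>\<beta> n\<bar> / (\<bar>\<alpha> n + x\<bar> * \<bar>\<alpha> n + y\<bar>) * \<bar>x - y\<bar>"
        by (simp add: abs_mult abs_minus_commute)
      also have "\<dots> \<le> \<eta> * \<bar>x - y\<bar>"
        using le by (intro mult_right_mono) auto
      finally show ?thesis .
    qed
  qed
qed

text \<open>The individual maps need not fix \<open>z1\<close>, but their defect there vanishes in
  the limit.\<close>

lemma fixed_point_limit: "(\<lambda>n. \<beta> n / (\<alpha> n + z1)) \<longlonglongrightarrow> z1"
proof -
  have "(\<lambda>n. \<beta> n / (\<alpha> n + z1)) \<longlonglongrightarrow> - (z1 * z2) / (- (z1 + z2) + z1)"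
    using z2_nonzero by (intro tendsto_intros alpha_lim beta_lim) auto
  then show ?thesis using z2_nonzero by simp
qed

text \<open>For one large \<open>M\<close>, the two preceding limits put \<open>approx M n\<close>
  near \<open>z1\<close> for all late \<open>n\<close>. From there on, contraction plus a small
  defect keeps a ball around \<open>z1\<close> invariant, so no further loss occurs as
  \<open>m\<close> grows.\<close>

lemma approx_joint_limit:
  assumes "\<epsilon> > 0"
  shows "\<exists>M N. \<forall>m\<ge>M. \<forall>n\<ge>N. \<bar>approx m n - z1\<bar> \<le> \<epsilon>"
proof -
  obtain \<eta> \<delta> N0 where c: "0 \<le> \<eta>" "\<eta> < 1" "0 < \<delta>"
    "\<And>n x y. n \<ge> N0 \<Longrightarrow> \<bar>x - z1\<bar> \<le> \<delta> \<Longrightarrow> \<bar>y - z1\<bar> \<le> \<delta> \<Longrightarrow>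
       \<bar>\<beta> n / (\<alpha> n + x) - \<beta> n / (\<alpha> n + y)\<bar> \<le> \<eta> * \<bar>x - y\<bar>"
    by (rule contraction_near_z1) blast
  define e where "e = min \<epsilon> \<delta>"
  have e: "e > 0" "e \<le> \<epsilon>" "e \<le> \<delta>" using assms c by (auto simp: e_def)
  \<comment> \<open>This is the defect that a ball of radius \<open>e\<close> tolerates:
    \<open>\<eta> * e + (1 - \<eta>) * e = e\<close>.\<close>
  have "(1 - \<eta>) * e > 0" using c e by simp
  from LIMSEQ_D[OF fixed_point_limit this] obtain N1 where
    N1: "\<And>n. n \<ge> N1 \<Longrightarrow> \<bar>\<beta> n / (\<alpha> n + z1) - z1\<bar> < (1 - \<eta>) * e" by auto
  let ?l = "\<lambda>m. z1 * z2 * (z2 ^ m - z1 ^ m) / (z2 ^ Suc m - z1 ^ Suc m)"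
  from LIMSEQ_D[OF periodic_approx_tendsto, of "e / 2"] e obtain M where
    M: "\<bar>?l M - z1\<bar> < e / 2" by fastforce
  from LIMSEQ_D[OF approx_tendsto[of M], of "e / 2"] e obtain N2 where
    N2: "\<And>n. n \<ge> N2 \<Longrightarrow> \<bar>approx M n - ?l M\<bar> < e / 2" by fastforce
  define N where "N = max N0 (max N1 N2)"
  \<comment> \<open>The quantifier over \<open>n\<close> stays inside the induction because the step
    from \<open>m\<close> to \<open>Suc m\<close> at \<open>n\<close> uses index
    \<open>n + 1\<close>.\<close>
  have "\<forall>n\<ge>N. \<bar>approx m n - z1\<bar> \<le> e" if "m \<ge> M" for m
    using that
  proof (induction m rule: dec_induct)
    case base
    show ?case
    proof (intro allI impI)
      fix n assume "n \<ge> N"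
      then have "n \<ge> N2" by (simp add: N_def)
      from N2[OF this] M have "\<bar>(approx M n - ?l M) + (?l M - z1)\<bar> < e / 2 + e / 2"
        by (intro le_less_trans[OF abs_triangle_ineq] add_strict_mono)
      then show "\<bar>approx M n - z1\<bar> \<le> e" by simp
    qed
  next
    case (step m)
    show ?case
    proof (intro allI impI)
      fix n assume n: "n \<ge> N"
      then have n': "n \<ge> N0" "n \<ge> N1" by (auto simp: N_def)
      have x: "\<bar>approx m (n + 1) - z1\<bar> \<le> e" using step n by simp
      have "\<bar>approx (Suc m) n - \<beta> n / (\<alpha> n + z1)\<bar> \<le> \<eta> * \<bar>approx m (n + 1) - z1\<bar>"
        using c(4)[OF n'(1), of "approx m (n + 1)" z1] x e c by simp
      also have "\<dots> \<le> \<eta> * e" using x c by (intro mult_left_mono) auto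
      finally show "\<bar>approx (Suc m) n - z1\<bar> \<le> e"
        using N1[OF n'(2)] by (simp add: algebra_simps)
    qed
  qed
  then show ?thesis using e by (intro exI[of _ M] exI[of _ N]) force
qed

lemma eventually_convergent_denominators_nonzero:
  "eventually (\<lambda>n. convergent (\<lambda>m. approx m n) \<and> (\<forall>m. \<alpha> n + approx m (n + 1) \<noteq> 0)) sequentially"
proof -
  obtain \<eta> \<delta> N0 where c: "0 \<le> \<eta>" "\<eta> < 1" "0 < \<delta>"
    "\<And>n x. n \<ge> N0 \<Longrightarrow> \<bar>x - z1\<bar> \<le> \<delta> \<Longrightarrow> \<alpha> n + x \<noteq> 0"
    "\<And>n x y. n \<ge> N0 \<Longrightarrow> \<bar>x - z1\<bar> \<le> \<delta> \<Longrightarrow> \<bar>y - z1\<bar> \<le> \<delta> \<Longrightarrow>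
       \<bar>\<beta> n / (\<alpha> n + x) - \<beta> n / (\<alpha> n + y)\<bar> \<le> \<eta> * \<bar>x - y\<bar>"
    by (rule contraction_near_z1) blast
  obtain M N1 where near: "\<And>m n. m \<ge> M \<Longrightarrow> n \<ge> N1 \<Longrightarrow> \<bar>approx m n - z1\<bar> \<le> \<delta>"
    using approx_joint_limit[OF c(3)] by blast
  define N where "N = max N0 N1"
  \<comment> \<open>Both approximants begin with the same \<open>j\<close> contracting maps, applied
    to tails that lie within \<open>\<delta>\<close> of \<open>z1\<close>.\<close>
  have diff: "\<bar>approx m n - approx m' n\<bar> \<le> \<eta> ^ j * (2 * \<delta>)"
    if "m \<ge> M + j" "m' \<ge> M + j" "n \<ge> N" for m m' n j
    using that
  proof (induction j arbitrary: m m' n)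
    case 0
    then show ?case using near[of m n] near[of m' n] by (simp add: N_def)
  next
    case (Suc j)
    obtain p p' where p: "m = Suc p" "m' = Suc p'"
      using Suc.prems by (metis Suc_le_D add_Suc_right)
    have ge: "p \<ge> M + j" "p' \<ge> M + j" using Suc.prems p by auto
    have "\<bar>approx m n - approx m' n\<bar> \<le> \<eta> * \<bar>approx p (n + 1) - approx p' (n + 1)\<bar>"
      unfolding p cf_approx.simps using Suc.prems ge by (intro c(5) near) (auto simp: N_def)
    also have "\<dots> \<le> \<eta> * (\<eta> ^ j * (2 * \<delta>))"
      using Suc.IH[OF ge, of "n + 1"] Suc.prems c by (intro mult_left_mono) auto
    finally show ?case by simp
  qed
  have conv: "convergent (\<lambda>m. approx m n)" if "n \<ge> N" for n
  proof -
    have "Cauchy (\<lambda>m. approx m n)"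
    proof (rule CauchyI)
      fix e :: real assume e: "e > 0"
      have "(\<lambda>j. \<eta> ^ j * (2 * \<delta>)) \<longlonglongrightarrow> 0 * (2 * \<delta>)"
        using c by (intro tendsto_intros LIMSEQ_power_zero) simp
      then have "eventually (\<lambda>j. \<eta> ^ j * (2 * \<delta>) < e) sequentially"
        using e by (intro order_tendstoD(2)[of _ 0]) auto
      then obtain j where "\<eta> ^ j * (2 * \<delta>) < e"
        by (auto simp: eventually_sequentially)
      then show "\<exists>K. \<forall>m\<ge>K. \<forall>m'\<ge>K. norm (approx m n - approx m' n) < e"
        using le_less_trans[OF diff[OF _ _ that]] by (intro exI[of _ "M + j"]) simp
    qed
    then show ?thesis by (simp add: Cauchy_convergent_iff)
  qed
  \<comment> \<open>The first \<open>M\<close> approximants may be far from \<open>z1\<close>; being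
    finitely many, they are handled one by one through their limits.\<close>
  have "eventually (\<lambda>n. \<forall>m\<in>{..<M}. \<alpha> n + approx m (n + 1) \<noteq> 0) sequentially"
    using eventually_denominator_nonzero by (intro eventually_ball_finite) auto
  moreover have "eventually (\<lambda>n. n \<ge> N) sequentially"
    by (rule eventually_ge_at_top)
  ultimately show ?thesis
  proof eventually_elim
    case (elim n)
    have "\<alpha> n + approx m (n + 1) \<noteq> 0" for m
    proof (cases "m < M")
      case False
      then show ?thesis using elim near[of m "n + 1"] by (intro c(4)) (auto simp: N_def)
    qed (use elim in auto)
    then show ?case using conv elim by blast
  qed
qed

lemma cf_value_tendsto: "cf_value \<longlonglongrightarrow> z1"
proof (rule tendstoI)
  fix e :: real assume "e > 0"
  then obtain M N where near: "\<And>m n. m \<ge> M \<Longrightarrow> n \<ge> N \<Longrightarrow> \<bar>approx m n - z1\<bar> \<le> e / 2"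
    using approx_joint_limit[of "e / 2"] by auto
  from eventually_convergent_denominators_nonzero eventually_ge_at_top[of N]
  show "eventually (\<lambda>n. dist (cf_value n) z1 < e) sequentially"
  proof eventually_elim
    case (elim n)
    then have "(\<lambda>m. approx m n) \<longlonglongrightarrow> cf_value n"
      by (simp add: cf_value_def convergent_LIMSEQ_iff)
    then have "(\<lambda>m. \<bar>approx m n - z1\<bar>) \<longlonglongrightarrow> \<bar>cf_value n - z1\<bar>"
      by (intro tendsto_intros)
    then have "\<bar>cf_value n - z1\<bar> \<le> e / 2"
      by (rule LIMSEQ_le_const2) (use near elim in blast)
    then show ?case using \<open>e > 0\<close> by (simp add: dist_real_def)
  qed
qed

text \<open>The recursion of the approximants is multiplied out before passing to the limit, so the
  limiting denominator never has to be inverted.\<close>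

lemma eventually_cf_value_rec:
  "eventually (\<lambda>n. cf_value n * (\<alpha> n + cf_value (n + 1)) = \<beta> n) sequentially"
proof -
  have conv1: "eventually (\<lambda>n. convergent (\<lambda>m. approx m (n + 1))) sequentially"
    using eventually_sequentially_Suc[THEN iffD2, OF eventually_convergent_denominators_nonzero]
    by eventually_elim simp
  from eventually_convergent_denominators_nonzero conv1 show ?thesis
  proof eventually_elim
    case (elim n)
    then have l: "(\<lambda>m. approx m n) \<longlonglongrightarrow> cf_value n" "(\<lambda>m. approx m (n + 1)) \<longlonglongrightarrow> cf_value (n + 1)"
      by (simp_all add: cf_value_def convergent_LIMSEQ_iff)
    have "(\<lambda>m. approx (Suc m) n * (\<alpha> n + approx m (n + 1))) \<longlonglongrightarrow> cf_value n * (\<alpha> n + cf_value (n + 1))"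
      by (intro tendsto_intros l LIMSEQ_Suc)
    moreover have "approx (Suc m) n * (\<alpha> n + approx m (n + 1)) = \<beta> n" for m
      using elim by simp
    ultimately show ?case by (simp add: LIMSEQ_const_iff)
  qed
qed

end

section \<open>Affine recursions\<close>

text \<open>By \<open>lim\<close>, \<open>L\<close> is asymptotically fixed by
  \<open>y \<mapsto> g m - h m * y\<close>. The distance of \<open>q n k\<close> to
  \<open>s k * L\<close> therefore shrinks by \<open>\<eta>\<close> up to an error governed by index
  \<open>k + Suc n\<close>, which is small uniformly in \<open>k\<close>.\<close>

lemma uniform_limit_affine_recursion:
  fixes q :: "nat \<Rightarrow> nat \<Rightarrow> real" and g h s :: "nat \<Rightarrow> real"
  assumes rec: "\<And>n k. k \<ge> k0 \<Longrightarrow> q (Suc n) k = s k * g (k + Suc n) - h (k + Suc n) * q n k"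
    and h: "\<And>m. m \<ge> k0 \<Longrightarrow> \<bar>h m\<bar> \<le> \<eta>" and \<eta>: "\<eta> < 1"
    and lim: "(\<lambda>m. g m - h m * L) \<longlonglongrightarrow> L"
    and s: "\<And>k. k \<ge> k0 \<Longrightarrow> \<bar>s k\<bar> \<le> B"
    and q0: "\<And>k. k \<ge> k0 \<Longrightarrow> \<bar>q 0 k\<bar> \<le> B"
  shows "uniform_limit {k0..} q (\<lambda>k. s k * L) sequentially"
proof -
  define \<epsilon> where "\<epsilon> m = \<bar>g m - h m * L - L\<bar>" for m
  define r where "r n k = \<bar>q n k - s k * L\<bar>" for n k
  have \<eta>0: "0 \<le> \<eta>" using h[of k0] by linarith
  have B0: "0 \<le> B" using s[of k0] by linarith
  have "(\<lambda>m. \<bar>g m - h m * L - L\<bar>) \<longlonglongrightarrow> \<bar>L - L\<bar>"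
    by (intro tendsto_intros lim)
  then have \<epsilon>: "\<epsilon> \<longlonglongrightarrow> 0" by (simp add: \<epsilon>_def[abs_def])
  have step: "r (Suc n) k \<le> \<eta> * r n k + B * \<epsilon> (k + Suc n)" if k: "k \<ge> k0" for n k
  proof -
    let ?m = "k + Suc n"
    have "q (Suc n) k - s k * L = s k * (g ?m - h ?m * L - L) - h ?m * (q n k - s k * L)"
      unfolding rec[OF k] by (simp add: algebra_simps)
    then have "r (Suc n) k \<le> \<bar>h ?m\<bar> * r n k + \<bar>s k\<bar> * \<epsilon> ?m"
      unfolding r_def \<epsilon>_def abs_mult[symmetric] by linarith
    also have "\<dots> \<le> \<eta> * r n k + B * \<epsilon> ?m"
      using h[of ?m] s[OF k] k by (intro add_mono mult_right_mono) (auto simp: r_def \<epsilon>_def)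
    finally show ?thesis .
  qed
  from \<epsilon> have "Bseq \<epsilon>" by (rule convergentI[THEN convergent_imp_Bseq])
  then obtain E where E: "E > 0" "\<And>m. \<epsilon> m \<le> E"
    unfolding Bseq_def by (metis abs_ge_self order_trans real_norm_def)
  \<comment> \<open>The first term bounds the initial distance, the second is the fixed point of
    \<open>y \<mapsto> \<eta> * y + B * E\<close>; so \<open>R\<close> bounds all distances.\<close>
  define R where "R = max (B + B * \<bar>L\<bar>) (B * E / (1 - \<eta>))"
  have "B * E / (1 - \<eta>) \<le> R" by (simp add: R_def)
  then have R1: "B * E \<le> (1 - \<eta>) * R" using \<eta> by (simp add: divide_simps mult.commute)
  have R: "r n k \<le> R" if k: "k \<ge> k0" for n k
  proof (induction n)
    case 0
    have "\<bar>s k\<bar> * \<bar>L\<bar> \<le> B * \<bar>L\<bar>" using s[OF k] by (intro mult_right_mono) auto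
    then have "r 0 k \<le> B + B * \<bar>L\<bar>"
      using q0[OF k] unfolding r_def abs_mult[symmetric] by linarith
    then show ?case by (simp add: R_def)
  next
    case (Suc n)
    have "\<eta> * r n k \<le> \<eta> * R" "B * \<epsilon> (k + Suc n) \<le> B * E"
      using Suc \<eta>0 B0 E by (auto intro: mult_left_mono)
    then show ?case using step[OF k, of n] R1 by (simp add: algebra_simps)
  qed
  show ?thesis
  proof (rule uniform_limitI)
    fix e :: real assume e: "e > 0"
    have "(\<lambda>m. B * \<epsilon> m) \<longlonglongrightarrow> B * 0" by (intro tendsto_intros \<epsilon>)
    then have "eventually (\<lambda>m. B * \<epsilon> m < (1 - \<eta>) * (e / 2)) sequentially"
      using e \<eta> by (intro order_tendstoD(2)[of _ 0]) auto
    then obtain N where N: "\<And>m. m \<ge> N \<Longrightarrow> B * \<epsilon> m < (1 - \<eta>) * (e / 2)"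
      by (auto simp: eventually_sequentially)
    \<comment> \<open>The level \<open>e / 2\<close> reproduces itself, since each new error is
      below \<open>(1 - \<eta>) * (e / 2)\<close>. The same \<open>N\<close> serves every
      \<open>k\<close> because \<open>k + Suc (N + j) \<ge> N\<close>.\<close>
    have decay: "r (N + j) k \<le> \<eta> ^ j * R + e / 2" if k: "k \<ge> k0" for j k
    proof (induction j)
      case 0
      show ?case using R[OF k, of N] e by simp
    next
      case (Suc j)
      have "\<eta> * r (N + j) k \<le> \<eta> * (\<eta> ^ j * R + e / 2)" using Suc \<eta>0 by (rule mult_left_mono)
      then show ?case using step[OF k, of "N + j"] N[of "k + Suc (N + j)"]
        by (simp add: algebra_simps)
    qed
    have "(\<lambda>j. \<eta> ^ j * R) \<longlonglongrightarrow> 0 * R"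
      using \<eta> \<eta>0 by (intro tendsto_intros LIMSEQ_power_zero) simp
    then have "eventually (\<lambda>j. \<eta> ^ j * R < e / 2) sequentially"
      using e by (intro order_tendstoD(2)[of _ 0]) auto
    then obtain J where J: "\<And>j. j \<ge> J \<Longrightarrow> \<eta> ^ j * R < e / 2"
      by (auto simp: eventually_sequentially)
    have "dist (q n k) (s k * L) < e" if n: "n \<ge> N + J" and k: "k \<in> {k0..}" for n k
    proof -
      have "r (N + (n - N)) k < e" using decay[of k "n - N"] J[of "n - N"] n k by fastforce
      then show ?thesis using n by (simp add: r_def dist_real_def)
    qed
    then show "eventually (\<lambda>n. \<forall>k\<in>{k0..}. dist (q n k) (s k * L) < e) sequentially"
      unfolding eventually_sequentially by blast
  qed
qed

lemma uniform_limit_shift: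
  fixes u :: "nat \<Rightarrow> 'a::metric_space"
  assumes "u \<longlonglongrightarrow> l"
  shows "uniform_limit X (\<lambda>n k. u (k + Suc n)) (\<lambda>_. l) sequentially"
proof (rule uniform_limitI)
  fix e :: real assume "e > 0"
  then obtain N where "\<And>n. n \<ge> N \<Longrightarrow> dist (u n) l < e"
    using assms by (auto simp: lim_sequentially)
  then show "eventually (\<lambda>n. \<forall>k\<in>X. dist (u (k + Suc n)) l < e) sequentially"
    unfolding eventually_sequentially by (intro exI[of _ N]) auto
qed

section \<open>Products of two by two matrices\<close>

lemma mat22_nth [simp]:
  "mat22 p q r s $ 1 $ 1 = p" "mat22 p q r s $ 1 $ 2 = q"
  "mat22 p q r s $ 2 $ 1 = r" "mat22 p q r s $ 2 $ 2 = s"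
  by (simp_all add: mat22_def)

lemma tendsto_mat22D:
  assumes "((\<lambda>k. mat22 (p k) (q k) (r k) (s k)) \<longlongrightarrow> mat22 p' q' r' s') F"
  shows "(p \<longlongrightarrow> p') F" "(q \<longlongrightarrow> q') F" "(r \<longlongrightarrow> r') F" "(s \<longlongrightarrow> s') F"
  using assms[THEN tendsto_vec_nth, THEN tendsto_vec_nth, of 1 1]
    assms[THEN tendsto_vec_nth, THEN tendsto_vec_nth, of 1 2]
    assms[THEN tendsto_vec_nth, THEN tendsto_vec_nth, of 2 1]
    assms[THEN tendsto_vec_nth, THEN tendsto_vec_nth, of 2 2]
  by simp_all

lemma axis_vector_matrix_mult_inner_axis:
  fixes P :: "real^'n^'m"
  shows "(axis i 1 v* P) \<bullet> axis j 1 = P $ i $ j"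
  by (simp add: inner_axis)
    (simp add: vector_matrix_mult_def axis_def if_distrib[of "\<lambda>z. z * _"] cong: if_cong)

lemma mat_prod_Suc_nth:
  "mat_prod A k (Suc n) $ i $ j
   = mat_prod A k n $ i $ 1 * A (k + Suc n) $ 1 $ j + mat_prod A k n $ i $ 2 * A (k + Suc n) $ 2 $ j"
  by (simp add: matrix_matrix_mult_def sum_2)

section \<open>Eigenvalues of the limit matrix\<close>

lemma rho_plus_rho1: "rho a b d \<theta> + rho1 a b d \<theta> = a + \<theta>"
  by (simp add: rho_def rho1_def field_simps)

lemma discriminant_nonneg:
  fixes a b d \<theta> :: real
  assumes "b * d \<ge> 0"
  shows "(a + \<theta>)\<^sup>2 + 4 * (b * d - a * \<theta>) \<ge> 0"
proof -
  have "(a + \<theta>)\<^sup>2 + 4 * (b * d - a * \<theta>) = (a - \<theta>)\<^sup>2 + 4 * (b * d)"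
    by (simp add: power2_eq_square algebra_simps)
  also have "\<dots> \<ge> 0" using assms by simp
  finally show ?thesis .
qed

lemma rho_times_rho1:
  assumes "b * d \<ge> 0"
  shows "rho a b d \<theta> * rho1 a b d \<theta> = a * \<theta> - b * d"
proof -
  let ?D = "(a + \<theta>)\<^sup>2 + 4 * (b * d - a * \<theta>)"
  have "?D \<ge> 0" using assms by (rule discriminant_nonneg)
  then have "sqrt ?D * sqrt ?D = ?D" by simp
  then have "(a + \<theta> + sqrt ?D) * (a + \<theta> - sqrt ?D) = 4 * (a * \<theta> - b * d)"
    by (simp add: algebra_simps power2_eq_square)
  then show ?thesis by (simp add: rho_def rho1_def)
qed

lemma abs_rho1_less_rho:
  assumes "b * d \<ge> 0" "a + \<theta> > 0" "rho a b d \<theta> \<noteq> rho1 a b d \<theta>"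
  shows "\<bar>rho1 a b d \<theta>\<bar> < rho a b d \<theta>"
proof -
  define t where "t = sqrt ((a + \<theta>)\<^sup>2 + 4 * (b * d - a * \<theta>))"
  have "t \<ge> 0" using discriminant_nonneg[OF assms(1)] by (simp add: t_def)
  moreover have "t \<noteq> 0" using assms(3) unfolding rho_def rho1_def t_def[symmetric] by auto
  ultimately have "t > 0" by simp
  then show ?thesis using assms(2) unfolding rho_def rho1_def t_def[symmetric] by (simp add: abs_less_iff)
qed

section \<open>Normalised products of matrices with vanishing lower right entry\<close>

text \<open>\<open>x_rec\<close> says that \<open>A m\<close> maps the column vector
  \<open>(1, d (m + 1) * x (m + 1))\<close> to \<open>inverse (x m)\<close> times
  \<open>(1, d m * x m)\<close>.\<close>

locale companion_product =
  fixes A :: "nat \<Rightarrow> real^2^2" and a b d x :: "nat \<Rightarrow> real" and k0 :: nat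
  assumes A_eq: "\<And>m. A m = mat22 (a m) (b m) (d m) 0"
    and x_rec: "\<And>m. m \<ge> k0 \<Longrightarrow> x m * (a m + b m * d (m + 1) * x (m + 1)) = 1"
begin

definition Q :: "2 \<Rightarrow> 2 \<Rightarrow> nat \<Rightarrow> nat \<Rightarrow> real" where
  "Q i j n k = mat_prod A k n $ i $ j / (\<Prod>l=1..n. inverse (x (k + l)))"

text \<open>In HOL \<open>inverse (inverse y) = y\<close> also at \<open>y = 0\<close>, so dividing
  by the product of inverses is multiplying by the product.\<close>

lemma Q_eq: "Q i j n k = mat_prod A k n $ i $ j * (\<Prod>l=1..n. x (k + l))"
  by (simp add: Q_def prod_inversef[unfolded comp_def] divide_inverse)

lemma Q_Suc:
  "Q i 1 (Suc n) k = (Q i 1 n k * a (k + Suc n) + Q i 2 n k * d (k + Suc n)) * x (k + Suc n)"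
  "Q i 2 (Suc n) k = Q i 1 n k * b (k + Suc n) * x (k + Suc n)"
  by (simp_all add: Q_eq mat_prod_Suc_nth A_eq algebra_simps del: mat_prod.simps)

text \<open>Component \<open>i\<close> of the vector \<open>(1, d (k + 1) * x (k + 1))\<close>; it
  becomes the prefactor of the limits of row \<open>i\<close>.\<close>

definition s :: "2 \<Rightarrow> nat \<Rightarrow> real" where
  "s i k = (if i = 1 then 1 else d (k + 1) * x (k + 1))"

text \<open>Row \<open>i\<close> of the normalised product is applied to the vector of index
  \<open>k + Suc n\<close>. The matrices carry it back to index \<open>k + 1\<close>, and the
  factors \<open>inverse (x m)\<close> cancel against the normalisation.\<close>

lemma Q_invariant:
  assumes "k \<ge> k0"
  shows "Q i 1 n k + Q i 2 n k * (d (k + Suc n) * x (k + Suc n)) = s i k"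
proof (induction n)
  case 0
  show ?case using exhaust_2[of i] by (auto simp: Q_eq s_def mat_def)
next
  case (Suc n)
  let ?m = "k + Suc n"
  have "Q i 1 (Suc n) k + Q i 2 (Suc n) k * (d (?m + 1) * x (?m + 1))
      = Q i 1 n k * (x ?m * (a ?m + b ?m * d (?m + 1) * x (?m + 1))) + Q i 2 n k * (d ?m * x ?m)"
    unfolding Q_Suc by (simp add: algebra_simps)
  also have "\<dots> = s i k" using x_rec[of ?m] Suc assms by simp
  finally show ?case by simp
qed

text \<open>The invariant eliminates the first entry of a row from the recursion of the second,
  which becomes affine. Assumption \<open>L\<close> states that \<open>L\<close> is the fixed point
  of its limit \<open>y \<mapsto> b0 * x0 - b0 * d0 * x0\<^sup>2 * y\<close>.\<close>

lemma uniform_limit_Q: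
  assumes b: "b \<longlonglongrightarrow> b0" and d: "d \<longlonglongrightarrow> d0" and x: "x \<longlonglongrightarrow> x0"
    and h: "\<And>m. m \<ge> k0 \<Longrightarrow> \<bar>b m * d m * (x m)\<^sup>2\<bar> \<le> \<eta>" and \<eta>: "\<eta> < 1"
    and L: "L * (1 + b0 * d0 * x0\<^sup>2) = b0 * x0"
  shows "uniform_limit {k0..} (Q i 2) (\<lambda>k. s i k * L) sequentially"
    and "uniform_limit {k0..} (Q i 1) (\<lambda>k. s i k * (1 - L * (d0 * x0))) sequentially"
proof -
  have dx: "(\<lambda>m. d m * x m) \<longlonglongrightarrow> d0 * x0" by (intro tendsto_intros d x)
  then have "Bseq (\<lambda>m. d m * x m)" by (rule convergentI[THEN convergent_imp_Bseq])
  then obtain B where B: "\<And>m. \<bar>d m * x m\<bar> \<le> B" unfolding Bseq_def by auto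
  \<comment> \<open>The 1 covers \<open>s 1 k\<close> and, below, the entries of the identity matrix
    at \<open>n = 0\<close>.\<close>
  have s_bound: "\<bar>s i k\<bar> \<le> max 1 B" for k using B[of "k + 1"] by (auto simp: s_def)
  show lim2: "uniform_limit {k0..} (Q i 2) (\<lambda>k. s i k * L) sequentially"
  proof (rule uniform_limit_affine_recursion[where g = "\<lambda>m. b m * x m"
        and h = "\<lambda>m. b m * d m * (x m)\<^sup>2" and B = "max 1 B", OF _ h \<eta> _ s_bound])
    show "Q i 2 (Suc n) k
        = s i k * (b (k + Suc n) * x (k + Suc n))
          - b (k + Suc n) * d (k + Suc n) * (x (k + Suc n))\<^sup>2 * Q i 2 n k"
      if "k \<ge> k0" for n k
      unfolding Q_Suc Q_invariant[OF that, of i n, symmetric]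
      by (simp add: algebra_simps power2_eq_square)
    have "(\<lambda>m. b m * x m - b m * d m * (x m)\<^sup>2 * L) \<longlonglongrightarrow> b0 * x0 - b0 * d0 * x0\<^sup>2 * L"
      by (intro tendsto_intros b d x)
    moreover have "b0 * x0 - b0 * d0 * x0\<^sup>2 * L = L"
      using L by (simp add: algebra_simps)
    ultimately show "(\<lambda>m. b m * x m - b m * d m * (x m)\<^sup>2 * L) \<longlonglongrightarrow> L" by simp
    show "\<bar>Q i 2 0 k\<bar> \<le> max 1 B" for k
      by (simp add: Q_eq mat_def le_max_iff_disj)
  qed
  \<comment> \<open>The invariant now returns the first entry from the second. Products of uniform
    limits require bounded limit functions, hence the side goals.\<close>
  have "uniform_limit {k0..} (\<lambda>n k. s i k - Q i 2 n k * (d (k + Suc n) * x (k + Suc n)))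
      (\<lambda>k. s i k - s i k * L * (d0 * x0)) sequentially"
  proof (intro uniform_limit_minus uniform_limit_const uniform_lim_mult[OF lim2 uniform_limit_shift[OF dx]])
    show "bounded ((\<lambda>k. s i k * L) ` {k0..})"
      using s_bound by (intro boundedI[of _ "max 1 B * \<bar>L\<bar>"])
        (auto simp: abs_mult intro!: mult_right_mono)
    show "bounded ((\<lambda>_. d0 * x0) ` {k0..})" by (auto intro: boundedI[of _ "\<bar>d0 * x0\<bar>"])
  qed
  moreover have "s i k - Q i 2 n k * (d (k + Suc n) * x (k + Suc n)) = Q i 1 n k"
    if "k \<in> {k0..}" for n k
    using Q_invariant[of k i n] that by simp
  ultimately show "uniform_limit {k0..} (Q i 1) (\<lambda>k. s i k * (1 - L * (d0 * x0))) sequentially"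
    by (rule uniform_limit_cong'[THEN iffD1, rotated 2]) (auto simp: algebra_simps)
qed

end

section \<open>Uniform limits for the given sequence of matrices\<close>

theorem theorem2:
  fixes a b d \<theta> :: real
    and as bs ds \<theta>s :: "nat \<Rightarrow> real"
    and \<phi> :: "2 \<Rightarrow> 2 \<Rightarrow> nat \<Rightarrow> real"
  assumes "a \<ge> 0" "b \<ge> 0" "d \<ge> 0" "\<theta> \<ge> 0"
    and "\<And>k. k \<ge> 1 \<Longrightarrow> as k \<ge> 0 \<and> bs k \<ge> 0 \<and> ds k \<ge> 0 \<and> \<theta>s k \<ge> 0"
    and "(\<lambda>k. mat22 (as k) (bs k) (ds k) (\<theta>s k)) \<longlonglongrightarrow> mat22 a b d \<theta>"
    and "a + \<theta> \<noteq> 0" "b \<noteq> 0" "b * d \<noteq> a * \<theta>"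
    and "rho a b d \<theta> \<noteq> rho1 a b d \<theta>"
    and "\<And>k. \<phi> 1 1 k = rho a b d \<theta> / (rho a b d \<theta> - rho1 a b d \<theta>)"
    and "\<And>k. \<phi> 1 2 k = b / (rho a b d \<theta> - rho1 a b d \<theta>)"
    and "\<And>k. \<phi> 2 1 k = d_til as bs ds \<theta>s (k + 1) / inverse (xi as bs ds \<theta>s (k + 1))
                        * (rho a b d \<theta> / (rho a b d \<theta> - rho1 a b d \<theta>))"
    and "\<And>k. \<phi> 2 2 k = d_til as bs ds \<theta>s (k + 1) / inverse (xi as bs ds \<theta>s (k + 1))
                        * (b / (rho a b d \<theta> - rho1 a b d \<theta>))"
  shows "\<exists>k0>0. (\<forall>n\<ge>k0. xi_defined as bs ds \<theta>s n) \<and>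
           (\<forall>i j. uniform_limit {k0..}
              (\<lambda>n k. ((axis i 1 v* mat_prod (A_mat as bs ds \<theta>s) k n) \<bullet> axis j 1)
                     / (\<Prod>l=1..n. inverse (xi as bs ds \<theta>s (k + l))))
              (\<lambda>k. \<phi> i j k) sequentially)"
proof -
  define r r1 where "r = rho a b d \<theta>" and "r1 = rho1 a b d \<theta>"
  define ta td x where "ta = a_til as bs \<theta>s" and "td = d_til as bs ds \<theta>s" and "x = xi as bs ds \<theta>s"
  \<comment> \<open>\<open>D\<close> is the limit of \<open>td\<close>, and
    \<open>b * D = b * d - a * \<theta>\<close> is minus the determinant of the limit matrix, that
    is \<open>- (r * r1)\<close>.\<close>
  define D where "D = d - a * \<theta> / b"
  have b0: "b > 0" using assms by simp
  have bd: "b * d \<ge> 0" using assms by simp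
  have T: "a + \<theta> > 0" using assms by simp
  have sum: "r + r1 = a + \<theta>" by (simp add: r_def r1_def rho_plus_rho1)
  have prod: "r * r1 = - (b * D)"
    using rho_times_rho1[OF bd] b0 by (simp add: r_def r1_def D_def algebra_simps)
  have less: "\<bar>r1\<bar> < r"
    using abs_rho1_less_rho[OF bd T] assms(10) by (simp add: r_def r1_def)
  have D0: "D \<noteq> 0" using assms(9) b0 by (simp add: D_def field_simps)
  have r0: "r > 0" "r1 \<noteq> 0" "r - r1 > 0" using less prod D0 b0 by auto

  have lims: "as \<longlonglongrightarrow> a" "bs \<longlonglongrightarrow> b" "ds \<longlonglongrightarrow> d" "\<theta>s \<longlonglongrightarrow> \<theta>"
    by (rule tendsto_mat22D[OF assms(6)])+
  have shift: "(\<lambda>n. f (n + 1)) \<longlonglongrightarrow> l" if "f \<longlonglongrightarrow> l" for f :: "nat \<Rightarrow> real" and l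
    using that by (rule LIMSEQ_ignore_initial_segment)
  have "(\<lambda>k. as k + bs k * \<theta>s (k + 1) / bs (k + 1)) \<longlonglongrightarrow> a + b * \<theta> / b"
    using assms(8) by (intro tendsto_intros shift lims)
  then have ta: "ta \<longlonglongrightarrow> a + \<theta>" using assms(8) by (simp add: ta_def a_til_def[abs_def])
  have td: "td \<longlonglongrightarrow> D"
    unfolding td_def d_til_def[abs_def] D_def using assms(8) by (intro tendsto_intros lims)

  have "(\<lambda>n. ta n * inverse (bs n) * inverse (td (n + 1))) \<longlonglongrightarrow> (a + \<theta>) * inverse b * inverse D"
    using assms(8) D0 by (intro tendsto_intros ta shift td lims)
  moreover have "(a + \<theta>) * inverse b * inverse D = (r + r1) / (b * D)"
    by (simp add: sum divide_inverse)
  also have "\<dots> = (r + r1) / - (r * r1)"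
    by (simp add: prod)
  also have "\<dots> = - (1 / r + 1 / r1)"
    using r0 by (simp add: field_simps)
  finally have alpha: "cf_alpha as bs ds \<theta>s \<longlonglongrightarrow> - (1 / r + 1 / r1)"
    by (simp add: cf_alpha_def[abs_def] ta_def td_def)
  have "(\<lambda>n. inverse (bs n) * inverse (td (n + 1))) \<longlonglongrightarrow> inverse b * inverse D"
    using assms(8) D0 by (intro tendsto_intros shift td lims)
  moreover have "inverse b * inverse D = - (1 / r * (1 / r1))"
  proof -
    have "inverse b * inverse D = 1 / (b * D)" by (simp add: field_simps)
    also have "\<dots> = 1 / - (r * r1)" by (simp add: prod)
    finally show ?thesis by simp
  qed
  ultimately have beta: "cf_beta as bs ds \<theta>s \<longlonglongrightarrow> - (1 / r * (1 / r1))"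
    by (simp add: cf_beta_def[abs_def] td_def)
  \<comment> \<open>Reciprocals reverse the order of moduli, so the dominant eigenvalue
    \<open>r\<close> yields the attracting fixed point \<open>1 / r\<close>.\<close>
  have "\<bar>1 / r\<bar> < \<bar>1 / r1\<bar>"
    using less r0 by (simp add: abs_divide frac_less2)
  with alpha beta
  interpret cf: limit_periodic_cf "cf_alpha as bs ds \<theta>s" "cf_beta as bs ds \<theta>s" "1 / r" "1 / r1"
    by unfold_locales
  have x_cf: "x = cf.cf_value" by (simp add: x_def xi_def cf.cf_value_def fun_eq_iff)
  have x: "x \<longlonglongrightarrow> 1 / r" unfolding x_cf by (rule cf.cf_value_tendsto)

  \<comment> \<open>Midpoint between 1 and \<open>\<bar>r1\<bar> / r\<close>, the limiting modulus
    of the linear coefficient in the affine recursion.\<close>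
  define \<eta> where "\<eta> = (1 + \<bar>r1\<bar> / r) / 2"
  have \<eta>: "\<bar>r1\<bar> / r < \<eta>" "\<eta> < 1" using less r0 by (auto simp: \<eta>_def field_simps)
  have ratio: "b * D * (1 / r)\<^sup>2 = - (r1 / r)"
  proof -
    have "b * D = - (r * r1)" by (simp add: prod)
    then show ?thesis using r0 by (simp add: power2_eq_square)
  qed
  have "(\<lambda>m. \<bar>bs m * td m * (x m)\<^sup>2\<bar>) \<longlonglongrightarrow> \<bar>b * D * (1 / r)\<^sup>2\<bar>"
    by (intro tendsto_intros lims td x)
  then have "eventually (\<lambda>m. \<bar>bs m * td m * (x m)\<^sup>2\<bar> < \<eta>) sequentially"
    using \<eta>(1) r0 by (intro order_tendstoD(2)) (auto simp: ratio)
  moreover have "eventually (\<lambda>n. bs n \<noteq> 0) sequentially"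
    by (rule tendsto_imp_eventually_ne[OF lims(2) assms(8)])
  moreover have td_ne: "eventually (\<lambda>n. td n \<noteq> 0) sequentially"
    by (rule tendsto_imp_eventually_ne[OF td D0])
  moreover have "eventually (\<lambda>n. td (n + 1) \<noteq> 0) sequentially"
    using eventually_sequentially_Suc[THEN iffD2, OF td_ne] by simp
  moreover have "eventually (\<lambda>n. x n \<noteq> 0) sequentially"
    by (rule tendsto_imp_eventually_ne[OF x]) (use r0 in simp)
  moreover note cf.eventually_convergent_denominators_nonzero
  moreover note cf.eventually_cf_value_rec
  ultimately have "eventually (\<lambda>n. xi_defined as bs ds \<theta>s n \<and> \<bar>bs n * td n * (x n)\<^sup>2\<bar> \<le> \<eta>
      \<and> x n * (ta n + bs n * td (n + 1) * x (n + 1)) = 1) sequentially"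
  proof eventually_elim
    case (elim n)
    \<comment> \<open>The recursion for the values, multiplied by \<open>bs n * td (n + 1)\<close>:
      this factor turns \<open>cf_alpha\<close> into \<open>ta n\<close> and \<open>cf_beta\<close>
      into 1.\<close>
    have "x n * (ta n + bs n * td (n + 1) * x (n + 1)) =
        bs n * td (n + 1) * (x n * (cf_alpha as bs ds \<theta>s n + x (n + 1)))"
      using elim by (simp add: cf_alpha_def ta_def td_def field_simps)
    also have "\<dots> = bs n * td (n + 1) * cf_beta as bs ds \<theta>s n"
      using elim by (simp add: x_cf)
    also have "\<dots> = 1"
      using elim(2,4) by (simp add: cf_beta_def td_def field_simps)
    finally show ?case
      using elim by (auto simp: xi_defined_def x_def td_def)
  qed
  then obtain N where N: "\<And>n. n \<ge> N \<Longrightarrow> xi_defined as bs ds \<theta>s n"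
      "\<And>n. n \<ge> N \<Longrightarrow> \<bar>bs n * td n * (x n)\<^sup>2\<bar> \<le> \<eta>"
      "\<And>n. n \<ge> N \<Longrightarrow> x n * (ta n + bs n * td (n + 1) * x (n + 1)) = 1"
    unfolding eventually_sequentially by blast

  \<comment> \<open>\<open>Suc N\<close> instead of \<open>N\<close> ensures a positive
    threshold.\<close>
  interpret P: companion_product "A_mat as bs ds \<theta>s" ta bs td x "Suc N"
    by unfold_locales (use N(3) in \<open>auto simp: A_mat_def ta_def td_def\<close>)
  \<comment> \<open>By \<open>ratio\<close> the fixed point equation reads
    \<open>L * (1 - r1 / r) = b / r\<close>.\<close>
  define L where "L = b / (r - r1)"
  have L: "L * (1 + b * D * (1 / r)\<^sup>2) = b * (1 / r)"
    unfolding ratio L_def using r0 by (simp add: field_simps)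
  have "1 - L * (D * (1 / r)) = 1 - (b * D) / ((r - r1) * r)" by (simp add: L_def)
  also have "\<dots> = 1 + r * r1 / ((r - r1) * r)" by (simp add: prod)
  also have "\<dots> = r / (r - r1)" using r0 by (simp add: field_simps)
  finally have L1: "1 - L * (D * (1 / r)) = r / (r - r1)" .
  have \<eta>N: "\<bar>bs m * td m * (x m)\<^sup>2\<bar> \<le> \<eta>" if "m \<ge> Suc N" for m using N(2)[of m] that by simp
  note U = P.uniform_limit_Q[OF lims(2) td x \<eta>N \<eta>(2) L, unfolded L1]
  \<comment> \<open>Dividing by \<open>inverse (x (k + 1))\<close> is multiplying by
    \<open>x (k + 1)\<close>, so the prefactor of the second row is \<open>P.s 2 k\<close>.\<close>
  have phi: "\<phi> i 1 = (\<lambda>k. P.s i k * (r / (r - r1)))" "\<phi> i 2 = (\<lambda>k. P.s i k * L)" for i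
    using exhaust_2[of i] assms(11-14)[folded td_def x_def r_def r1_def]
    by (auto simp: fun_eq_iff P.s_def L_def divide_inverse)
  have "uniform_limit {Suc N..} (P.Q i j) (\<phi> i j) sequentially" for i j
    using exhaust_2[of j] U[of i] by (auto simp: phi)
  then have "\<forall>i j. uniform_limit {Suc N..}
      (\<lambda>n k. mat_prod (A_mat as bs ds \<theta>s) k n $ i $ j / (\<Prod>l=1..n. inverse (x (k + l))))
      (\<phi> i j) sequentially"
    unfolding P.Q_def[abs_def] by blast
  then show ?thesis
    using N(1) unfolding axis_vector_matrix_mult_inner_axis x_def
    by (intro exI[of _ "Suc N"]) auto
qed

end
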